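(* Let $f:\mathbb{R}^n\to(-\infty,\infty]$ be proper and lower semicontinuous and let $\bar{x}\in\operatorname{dom}\partial f$. Let $U\subseteq\operatorname{dom}\partial f$ be a nonempty neighborhood of $\bar{x}$ and let $\eta\in(0,\infty]$. Let $\varphi\in\Phi_\eta$ be concave and suppose that $f$ has the generalized concave KL property at $\bar{x}$ with respect to $U$, $\eta$ and $\varphi$. Then the exact modulus of the generalized concave KL property of $f$ at $\bar{x}$ with respect to $U$ and $\eta$, denoted by $\tilde{\varphi}$, is well-defined, concave and satisfies $$\tilde{\varphi}(t)\leq\varphi(t)\quad\text{for all } t\in[0,\eta).$$ Moreover, the function $f$ has the generalized concave KL property at $\bar{x}$ with respect to $U$, $\eta$ and $\tilde{\varphi}$. Consequently, the exact modulus $\tilde\varphi$ satisfies $$\tilde{\varphi}=\inf\big\{\varphi\in\Phi_\eta:\ \varphi \text{ is a concave desingularizing function of } f \text{ at } \bar{x} \text{ with respect to } U \text{ and } \eta\big\}.$$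
   Context: $\mathbb{R}_+=[0,\infty)$. For $r_1,r_2\in[-\infty,\infty]$, $[r_1<f<r_2]=\{x\in\mathbb{R}^n: r_1<f(x)<r_2\}$, and $[0<f-f(\bar x)<\eta]$ is understood accordingly. $\partial f$ is the limiting subdifferential: for $x\in\operatorname{dom} f$, $v\in\hat\partial f(x)$ (Fréchet subgradient) if $f(y)\ge f(x)+\langle v,y-x\rangle+o(\|y-x\|)$ for every $y\in\operatorname{dom} f$, and $v\in\partial f(x)$ if there are $x_k\to x$ with $f(x_k)\to f(x)$ and $v_k\in\hat\partial f(x_k)$ with $v_k\to v$. $\operatorname{dom}\partial f=\{x:\partial f(x)\ne\emptyset\}$. $\operatorname{dist}(0,K)=\inf\{\|y\|:y\in K\}$, and $\operatorname{dist}^{-1}(0,K)=1/\operatorname{dist}(0,K)$. For $\eta\in(0,\infty]$, $\Phi_\eta$ is the class of functions $\varphi:[0,\eta)\to\mathbb{R}_+$ such that $\varphi$ is right-continuous at $0$ with $\varphi(0)=0$, and $\varphi$ is strictly increasing on $[0,\eta)$. $\varphi'_-(t)=\lim_{s\to t^-}\frac{\varphi(s)-\varphi(t)}{s-t}$ denotes the left derivative. Generalized concave KL property: $f$ has the (pointwise) generalized concave KL property at $\bar x\in\operatorname{dom}\partial f$ if there exist a neighborhood $U$ of $\bar x$, $\eta\in(0,\infty]$ and a concave $\varphi\in\Phi_\eta$ such that for all $x\in U\cap[0<f-f(\bar{x})<\eta]$, $$\varphi'_-\big(f(x)-f(\bar{x})\big)\cdot\operatorname{dist}\big(0,\partial f(x)\big)\geq1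 .$$ In this case $f$ is said to have the property at $\bar x$ with respect to $U$, $\eta$ and $\varphi$, and the concave function $\varphi\in\Phi_\eta$ is called a concave desingularizing function of $f$ at $\bar x$ with respect to $U$ and $\eta$. Exact modulus: for $\bar x\in\operatorname{dom}\partial f$, a neighborhood $U\subseteq\operatorname{dom}\partial f$ of $\bar x$ and $\eta\in(0,\infty]$, define $h$ on $(0,\eta)$ by $$h(s)=\sup\big\{\operatorname{dist}^{-1}\big(0,\partial f(x)\big): x\in U\cap[0<f-f(\bar{x})<\eta],\ s\leq f(x)-f(\bar{x})\big\}.$$ Suppose that $h(s)<\infty$ for $s\in(0,\eta)$. The exact modulus of the generalized concave KL property of $f$ at $\bar x$ with respect to $U$ and $\eta$ is the function $\tilde\varphi:[0,\eta)\to\mathbb{R}_+$ with $\tilde\varphi(t)=\int_0^t h(s)\,ds$ for $t\in(0,\eta)$ and $\tilde\varphi(0)=0$. If $U\cap[0<f-f(\bar x)<\eta]=\emptyset$, the exact modulus with respect to $U$ and $\eta$ is set to be $\tilde\varphi(t)\equiv0$.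
   Formalization: The exact modulus need not be strictly increasing on [0,η) (f=|x|, U=(-1/2,1/2), η=2), so the KL property for it is stated with strict increase only up to values reached by f-f(x̄) on U, nondecreasing beyond; the full property is claimed when all of [0,η) is reached. *)

theory Defs
  imports "HOL-Analysis.Analysis" "HOL-Library.Landau_Symbols"
begin

definition dom_ext :: "('a \<Rightarrow> ereal) \<Rightarrow> 'a set" where
  "dom_ext f = {x. f x < \<infinity>}"

definition proper_fun :: "('a \<Rightarrow> ereal) \<Rightarrow> bool" where
  "proper_fun f \<longleftrightarrow> (\<forall>x. f x \<noteq> -\<infinity>) \<and> (\<exists>x. f x < \<infinity>)"

definition lsc_fun :: "('a::topological_space \<Rightarrow> ereal) \<Rightarrow> bool" where
  "lsc_fun f \<longleftrightarrow> (\<forall>x. f x \<le> Liminf (at x) f)"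

text \<open>The remainder \<open>r\<close> is the term \<open>o(\<parallel>y - x\<parallel>)\<close>; it is only constrained near \<open>x\<close>.\<close>
definition frechet_subdiff :: "('a::euclidean_space \<Rightarrow> ereal) \<Rightarrow> 'a \<Rightarrow> 'a set" where
  "frechet_subdiff f x =
     {v. x \<in> dom_ext f \<and>
         (\<exists>r::'a \<Rightarrow> real. r \<in> o[at x](\<lambda>y. norm (y - x)) \<and>
            (\<forall>y\<in>dom_ext f. f y \<ge> f x + ereal (v \<bullet> (y - x) + r y)))}"

definition limiting_subdiff :: "('a::euclidean_space \<Rightarrow> ereal) \<Rightarrow> 'a \<Rightarrow> 'a set" where
  "limiting_subdiff f x =
     {v. x \<in> dom_ext f \<and>
         (\<exists>(X :: nat \<Rightarrow> 'a) (V :: nat \<Rightarrow> 'a).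
            X \<longlonglongrightarrow> x \<and> (\<lambda>k. f (X k)) \<longlonglongrightarrow> f x \<and>
            (\<forall>k. V k \<in> frechet_subdiff f (X k)) \<and> V \<longlonglongrightarrow> v)}"

definition dom_subdiff :: "('a::euclidean_space \<Rightarrow> ereal) \<Rightarrow> 'a set" where
  "dom_subdiff f = {x. limiting_subdiff f x \<noteq> {}}"

text \<open>Distances from the origin take values in \<open>[0,\<infinity>]\<close>, so that the distance to the
  empty set is \<open>\<infinity>\<close> (the library function \<open>infdist\<close> would give \<open>0\<close>).\<close>
definition dist_zero :: "'a::real_normed_vector set \<Rightarrow> ennreal" where
  "dist_zero K = (INF y\<in>K. ennreal (norm y))"

text \<open>The set \<open>[0 < f - f(xb) < \<eta>]\<close>.\<close>
definition level_band :: "('a \<Rightarrow> ereal) \<Rightarrow> 'a \<Rightarrow> ereal \<Rightarrow> 'a set" where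
  "level_band f xb \<eta> = {x. 0 < f x - f xb \<and> f x - f xb < \<eta>}"

text \<open>The interval \<open>[0,\<eta>)\<close>, where \<open>\<eta>\<close> may be \<open>\<infinity>\<close>.\<close>
definition ivl0 :: "ereal \<Rightarrow> real set" where
  "ivl0 \<eta> = {t. 0 \<le> t \<and> ereal t < \<eta>}"

text \<open>Functions \<open>[0,\<eta>) \<rightarrow> [0,\<infinity>)\<close> are represented by total functions on the reals whose
  values outside \<open>[0,\<eta>)\<close> are irrelevant.\<close>
definition Phi_class :: "ereal \<Rightarrow> (real \<Rightarrow> real) set" where
  "Phi_class \<eta> =
     {\<phi>. (\<forall>t\<in>ivl0 \<eta>. 0 \<le> \<phi> t) \<and> continuous (at_right 0) \<phi> \<and> \<phi> 0 = 0 \<and>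
         strict_mono_on (ivl0 \<eta>) \<phi>}"

text \<open>The limit exists at every \<open>t \<in> (0,\<eta>)\<close> if \<open>\<phi>\<close> is concave on \<open>[0,\<eta>)\<close>; the left
  derivative is only used in this situation.\<close>
definition left_deriv :: "(real \<Rightarrow> real) \<Rightarrow> real \<Rightarrow> real" where
  "left_deriv \<phi> t = Lim (at_left t) (\<lambda>s. (\<phi> s - \<phi> t) / (s - t))"

definition KL_inequality ::
  "('a::euclidean_space \<Rightarrow> ereal) \<Rightarrow> 'a \<Rightarrow> 'a set \<Rightarrow> ereal \<Rightarrow> (real \<Rightarrow> real) \<Rightarrow> bool" where
  "KL_inequality f xb U \<eta> \<phi> \<longleftrightarrow>
     (\<forall>x \<in> U \<inter> level_band f xb \<eta>.
        ennreal (left_deriv \<phi> (real_of_ereal (f x - f xb))) * dist_zero (limiting_subdiff f x) \<ge> 1)"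

text \<open>The generalized concave KL property of \<open>f\<close> at \<open>xb\<close> with respect to \<open>U\<close>, \<open>\<eta>\<close> and \<open>\<phi>\<close>;
  equivalently, \<open>\<phi>\<close> is a concave desingularizing function of \<open>f\<close> at \<open>xb\<close> with respect to
  \<open>U\<close> and \<open>\<eta>\<close>.\<close>
definition concave_KL_wrt ::
  "('a::euclidean_space \<Rightarrow> ereal) \<Rightarrow> 'a \<Rightarrow> 'a set \<Rightarrow> ereal \<Rightarrow> (real \<Rightarrow> real) \<Rightarrow> bool" where
  "concave_KL_wrt f xb U \<eta> \<phi> \<longleftrightarrow>
     xb \<in> dom_subdiff f \<and> xb \<in> interior U \<and> 0 < \<eta> \<and>
     \<phi> \<in> Phi_class \<eta> \<and> concave_on (ivl0 \<eta>) \<phi> \<and> KL_inequality f xb U \<eta> \<phi>"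

text \<open>The function \<open>h\<close> whose integral is the exact modulus. The supremum is taken in \<open>[0,\<infinity>]\<close>,
  hence \<open>h s = 0\<close> if no point of \<open>U\<close> satisfies the constraints.\<close>
definition modulus_rate ::
  "('a::euclidean_space \<Rightarrow> ereal) \<Rightarrow> 'a \<Rightarrow> 'a set \<Rightarrow> ereal \<Rightarrow> real \<Rightarrow> ennreal" where
  "modulus_rate f xb U \<eta> s =
     (SUP x \<in> {x \<in> U \<inter> level_band f xb \<eta>. ereal s \<le> f x - f xb}.
        1 / dist_zero (limiting_subdiff f x))"

definition exact_modulus ::
  "('a::euclidean_space \<Rightarrow> ereal) \<Rightarrow> 'a \<Rightarrow> 'a set \<Rightarrow> ereal \<Rightarrow> real \<Rightarrow> real" where
  "exact_modulus f xb U \<eta> t =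
     (if U \<inter> level_band f xb \<eta> = {} \<or> t = 0 then 0
      else LINT s:{0<..<t}|lborel. enn2real (modulus_rate f xb U \<eta> s))"

text \<open>The Lebesgue integral of a non-integrable function is \<open>0\<close> by convention, so that
  finiteness of \<open>h\<close> and of its integrals has to be stated explicitly.\<close>
definition exact_modulus_well_defined ::
  "('a::euclidean_space \<Rightarrow> ereal) \<Rightarrow> 'a \<Rightarrow> 'a set \<Rightarrow> ereal \<Rightarrow> bool" where
  "exact_modulus_well_defined f xb U \<eta> \<longleftrightarrow>
     (\<forall>s. 0 < s \<and> ereal s < \<eta> \<longrightarrow> modulus_rate f xb U \<eta> s < \<infinity>) \<and>
     (\<forall>t. 0 < t \<and> ereal t < \<eta> \<longrightarrow>
        set_integrable lborel {0<..<t} (\<lambda>s. enn2real (modulus_rate f xb U \<eta> s))) \<and>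
     (\<forall>t\<in>ivl0 \<eta>. 0 \<le> exact_modulus f xb U \<eta> t)"

text \<open>The exact modulus is constant above the values of \<open>f - f(xb)\<close> attained on
  \<open>U \<inter> [0 < f - f(xb) < \<eta>]\<close>, and may therefore fail to be strictly increasing on \<open>[0,\<eta>)\<close>:
  for \<open>f = \<bar>\<cdot>\<bar>\<close> on the real line, \<open>xb = 0\<close>, \<open>U = (-1/2,1/2)\<close> and \<open>\<eta> = 2\<close> it is \<open>min t (1/2)\<close>.
  This set is the part of \<open>[0,\<eta>)\<close> reached by those values.\<close>
definition reached_ivl ::
  "('a::euclidean_space \<Rightarrow> ereal) \<Rightarrow> 'a \<Rightarrow> 'a set \<Rightarrow> ereal \<Rightarrow> real set" where
  "reached_ivl f xb U \<eta> =
     {t \<in> ivl0 \<eta>. t = 0 \<or> (\<exists>x \<in> U \<inter> level_band f xb \<eta>. ereal t \<le> f x - f xb)}"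

text \<open>The KL property with respect to \<open>U\<close>, \<open>\<eta>\<close> and \<open>\<phi>\<close>, where \<open>\<phi>\<close> satisfies all requirements
  of a concave desingularizing function except that it is nondecreasing on \<open>[0,\<eta>)\<close> and
  strictly increasing on the reached part of \<open>[0,\<eta>)\<close>. It coincides with
  \<open>concave_KL_wrt\<close> if all of \<open>[0,\<eta>)\<close> is reached.\<close>
definition concave_KL_wrt_reached ::
  "('a::euclidean_space \<Rightarrow> ereal) \<Rightarrow> 'a \<Rightarrow> 'a set \<Rightarrow> ereal \<Rightarrow> (real \<Rightarrow> real) \<Rightarrow> bool" where
  "concave_KL_wrt_reached f xb U \<eta> \<phi> \<longleftrightarrow>
     xb \<in> dom_subdiff f \<and> xb \<in> interior U \<and> 0 < \<eta> \<and>
     (\<forall>t\<in>ivl0 \<eta>. 0 \<le> \<phi> t) \<and> continuous (at_right 0) \<phi> \<and> \<phi> 0 = 0 \<and>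
     mono_on (ivl0 \<eta>) \<phi> \<and> strict_mono_on (reached_ivl f xb U \<eta>) \<phi> \<and>
     concave_on (ivl0 \<eta>) \<phi> \<and> KL_inequality f xb U \<eta> \<phi>"

end

theory Submission
  imports Defs
begin

text \<open>
  Write \<open>h\<close> for the rate and \<open>m(t)\<close> for its integral over \<open>(0,t)\<close>, the exact modulus.
  Everything rests on comparing increments over intervals \<open>(r,s)\<close> with the values of the
  nonincreasing function \<open>h\<close>, so that no derivative ever has to be integrated.

  \<^item> A concave \<open>\<psi>\<close> with the KL property satisfies \<open>h s * (s - r) \<le> \<psi> s - \<psi> r\<close> for \<open>r < s\<close>
    (\<open>rate_le_slope\<close>): at a point \<open>x\<close> with \<open>f x - f xb = t \<ge> s\<close>, the reciprocal of the distance
    is at most the left derivative of \<open>\<psi>\<close> at \<open>t\<close>, hence at most the slope of \<open>\<psi>\<close> over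
    \<open>(r,t)\<close>, hence at most its slope over \<open>(r,s)\<close>. Since \<open>h\<close> is nonincreasing, it can be integrated
    by Riemann sums whose terms telescope against \<open>\<psi>\<close> (\<open>nn_integral_le_of_rate_bound\<close>). So
    \<open>h\<close> is integrable on \<open>(0,t)\<close> and \<open>m \<le> \<psi>\<close>.

  \<^item> Monotonicity of \<open>h\<close> gives \<open>h t * (t - s) \<le> m t - m s \<le> h s * (t - s)\<close> for \<open>s < t\<close>. Both
    inequalities together say that \<open>m\<close> is concave, and the left one alone that the left derivative of
    \<open>m\<close> at \<open>t\<close> is at least \<open>h t\<close>, which is the KL inequality. It also shows that \<open>m\<close> is strictly
    increasing as long as \<open>h\<close> is positive, that is, on the reached part of the interval. Right-continuity
    at \<open>0\<close> follows from \<open>0 \<le> m \<le> \<phi>\<close>.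

  \<^item> The infimum formula needs functions that are strictly increasing on the whole interval. The
    functions \<open>m t + \<epsilon> * t\<close> with \<open>\<epsilon> > 0\<close> are, they inherit concavity and the KL inequality, and they
    tend to \<open>m\<close> as \<open>\<epsilon>\<close> tends to \<open>0\<close>.
\<close>

section \<open>Left derivatives of concave functions\<close>

lemma convex_ivl0: "convex (ivl0 \<eta>)"
proof -
  have "is_interval (ivl0 \<eta>)"
    unfolding is_interval_1 ivl0_def
    by (auto intro: le_less_trans[OF ereal_less_eq(3)[THEN iffD2]])
  then show ?thesis by (rule is_interval_convex)
qed

lemma ivl0_downward: "t \<in> ivl0 \<eta> \<Longrightarrow> 0 \<le> s \<Longrightarrow> s \<le> t \<Longrightarrow> s \<in> ivl0 \<eta>"
  by (auto simp: ivl0_def intro: le_less_trans[OF ereal_less_eq(3)[THEN iffD2]])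

lemma slope_commute: "(a - b) / (c - d) = (b - a) / (d - c)" for a b c d :: real
  by (metis minus_diff_eq minus_divide_divide)

lemma concave_on_slope_le:
  fixes \<psi> :: "real \<Rightarrow> real"
  assumes "concave_on A \<psi>" "r \<in> A" "t \<in> A" "r < s" "s < t"
  shows "(\<psi> t - \<psi> r) / (t - r) \<le> (\<psi> s - \<psi> r) / (s - r)"
    and "(\<psi> t - \<psi> s) / (t - s) \<le> (\<psi> t - \<psi> r) / (t - r)"
proof -
  have neg: "(- a - - b) / (c - d) = - ((a - b) / (c - d))" for a b c d :: real
    by (metis minus_diff_minus minus_divide_left)
  note convex_on_slope_le[OF assms(1)[unfolded concave_on_def] assms(2-5)]
  then show "(\<psi> t - \<psi> r) / (t - r) \<le> (\<psi> s - \<psi> r) / (s - r)"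
    and "(\<psi> t - \<psi> s) / (t - s) \<le> (\<psi> t - \<psi> r) / (t - r)"
    unfolding neg neg_le_iff_le by (simp_all only: slope_commute[of "\<psi> r"] slope_commute[of "\<psi> s" "\<psi> t"])
qed

text \<open>By concavity the slope over \<open>(s,t)\<close> decreases as \<open>s\<close> increases to \<open>t\<close>, and it is bounded
  below by \<open>0\<close> by monotonicity. So the limit in the definition of the left derivative exists;
  without this, nothing is known about the value of \<open>Lim\<close>.\<close>
lemma tendsto_left_deriv:
  assumes conc: "concave_on (ivl0 \<eta>) \<psi>" and mono: "mono_on (ivl0 \<eta>) \<psi>"
    and t: "t \<in> ivl0 \<eta>" "0 < t"
  shows "((\<lambda>s. (\<psi> s - \<psi> t) / (s - t)) \<longlongrightarrow> left_deriv \<psi> t) (at_left t)"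
proof -
  define q where "q = (\<lambda>s. (\<psi> s - \<psi> t) / (s - t))"
  have q_eq: "q s = (\<psi> t - \<psi> s) / (t - s)" for s
    unfolding q_def by (rule slope_commute)
  have in_ivl: "s \<in> ivl0 \<eta>" if "s \<in> {0..<t}" for s
    using that t by (auto intro: ivl0_downward)
  have "((\<lambda>s. - q s) \<longlongrightarrow> Sup ((\<lambda>s. - q s) ` ({..<t} \<inter> {0..<t}))) (at t within ({..<t} \<inter> {0..<t}))"
  proof (rule Lim_left_bound)
    fix a b assume "a \<in> {0..<t}" "b \<in> {0..<t}" "b < t" "a \<le> b"
    then show "- q a \<le> - q b"
      using concave_on_slope_le(2)[OF conc in_ivl t(1), of a b] by (cases "a = b") (auto simp: q_eq)
  next
    fix b assume "b \<in> {0..<t}" "b < t"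
    then show "- q b \<le> 0"
      using mono_onD[OF mono in_ivl t(1), of b] by (auto simp: q_eq)
  qed
  moreover have "at t within ({..<t} \<inter> {0..<t}) = at_left t"
    by (rule at_within_nhd[of t "{0<..}"]) (use t in auto)
  ultimately have "((\<lambda>s. - q s) \<longlongrightarrow> Sup ((\<lambda>s. - q s) ` ({..<t} \<inter> {0..<t}))) (at_left t)"
    by simp
  from tendsto_minus[OF this] obtain L where L: "(q \<longlongrightarrow> L) (at_left t)"
    by auto
  then have "left_deriv \<psi> t = L"
    unfolding left_deriv_def q_def by (intro tendsto_Lim) simp_all
  with L show ?thesis
    by (simp add: q_def)
qed

lemma left_deriv_le_slope:
  assumes conc: "concave_on (ivl0 \<eta>) \<psi>" and mono: "mono_on (ivl0 \<eta>) \<psi>"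
    and t: "t \<in> ivl0 \<eta>" and s: "0 \<le> s" "s < t"
  shows "left_deriv \<psi> t \<le> (\<psi> t - \<psi> s) / (t - s)"
proof -
  have "(\<psi> u - \<psi> t) / (u - t) \<le> (\<psi> t - \<psi> s) / (t - s)" if "u \<in> {s<..<t}" for u
  proof -
    have "(\<psi> u - \<psi> t) / (u - t) = (\<psi> t - \<psi> u) / (t - u)"
      by (rule slope_commute)
    then show ?thesis
      using concave_on_slope_le(2)[OF conc ivl0_downward[OF t s(1)] t, of u] that s by simp
  qed
  with s show ?thesis
    by (intro tendsto_upperbound[OF tendsto_left_deriv[OF conc mono t]])
       (auto intro!: eventually_at_leftI[of s])
qed

lemma left_deriv_ge:
  assumes conc: "concave_on (ivl0 \<eta>) \<psi>" and mono: "mono_on (ivl0 \<eta>) \<psi>"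
    and t: "t \<in> ivl0 \<eta>" "0 < t"
    and c: "\<And>s. 0 \<le> s \<Longrightarrow> s < t \<Longrightarrow> c * (t - s) \<le> \<psi> t - \<psi> s"
  shows "c \<le> left_deriv \<psi> t"
proof (rule tendsto_lowerbound[OF tendsto_left_deriv[OF conc mono t]])
  have "c \<le> (\<psi> s - \<psi> t) / (s - t)" if "s \<in> {0<..<t}" for s
  proof -
    have "(\<psi> s - \<psi> t) / (s - t) = (\<psi> t - \<psi> s) / (t - s)"
      by (rule slope_commute)
    then show ?thesis
      using c[of s] that by (simp add: pos_le_divide_eq)
  qed
  then show "\<forall>\<^sub>F s in at_left t. c \<le> (\<psi> s - \<psi> t) / (s - t)"
    by (intro eventually_at_leftI[of 0]) (use t in auto)
qed simp

section \<open>Integrals of nonincreasing functions\<close>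

lemma borel_measurable_antimono_ennreal:
  fixes h :: "real \<Rightarrow> ennreal"
  assumes "antimono h"
  shows "h \<in> borel_measurable borel"
proof (rule borel_measurableI_greater)
  fix y
  have "is_interval {s. y < h s}"
    unfolding is_interval_1 using antimonoD[OF assms] by (auto intro: less_le_trans)
  then show "{s \<in> space borel. y < h s} \<in> sets borel"
    by (simp add: real_interval_borel_measurable)
qed

text \<open>The rate may blow up at \<open>0\<close>, so the interval is exhausted by the sets \<open>[b/(n+1), b)\<close>. On each of
  them the upper Riemann sum with mesh \<open>d = b/(n+1)\<close> has the terms \<open>h (i * d) * d\<close> for
  \<open>i = 1, \<dots>, n\<close>, each of which is at most the increment of \<open>\<psi>\<close> over the preceding cell
  \<open>((i-1) * d, i * d)\<close>. The sum of these increments telescopes. It is this shift by one cell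
  that makes an upper sum, rather than a lower one, comparable with \<open>\<psi>\<close>.\<close>
lemma nn_integral_le_of_rate_bound:
  fixes h :: "real \<Rightarrow> ennreal"
  assumes h: "antimono h" and "0 < b" and mono: "mono_on {0..b} \<psi>"
    and rate: "\<And>r s. 0 \<le> r \<Longrightarrow> r < s \<Longrightarrow> s \<le> b \<Longrightarrow> h s * ennreal (s - r) \<le> ennreal (\<psi> s - \<psi> r)"
  shows "(\<integral>\<^sup>+s\<in>{0<..<b}. h s \<partial>lborel) \<le> ennreal (\<psi> b - \<psi> 0)"
proof -
  define N where "N = density lborel h"
  have [measurable]: "h \<in> borel_measurable borel"
    using h by (rule borel_measurable_antimono_ennreal)
  have N_eq: "emeasure N A = (\<integral>\<^sup>+s\<in>A. h s \<partial>lborel)" if "A \<in> sets borel" for A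
    using that unfolding N_def by (subst emeasure_density) (auto simp: mult.commute)
  have [measurable_cong, simp]: "sets N = sets borel"
    by (simp add: N_def)
  have piece: "emeasure N {u..<v} \<le> h u * ennreal (v - u)" if "u \<le> v" for u v
  proof -
    have "emeasure N {u..<v} \<le> (\<integral>\<^sup>+s\<in>{u..<v}. h u \<partial>lborel)"
      unfolding N_eq[of "{u..<v}", simplified]
      by (intro nn_integral_mono) (auto simp: indicator_def intro: antimonoD[OF h])
    then show ?thesis
      using that by (simp add: nn_integral_cmult_indicator)
  qed
  have cells: "emeasure N {d..<real (Suc k) * d} \<le> ennreal (\<psi> (real k * d) - \<psi> 0)"
    if "0 < d" "real k * d \<le> b" for d k
    using that
  proof (induction k)
    case 0
    then show ?case by simp
  next
    case (Suc k)
    have kd: "real k * d \<le> b" "0 \<le> real k * d" "real k * d \<le> real (Suc k) * d"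
      using Suc.prems by (auto simp: algebra_simps)
    have "{d..<real (Suc (Suc k)) * d} =
        {d..<real (Suc k) * d} \<union> {real (Suc k) * d..<real (Suc (Suc k)) * d}"
      using Suc.prems(1) by (intro ivl_disj_un_two(3)[symmetric]) (auto simp: algebra_simps)
    then have "emeasure N {d..<real (Suc (Suc k)) * d} \<le>
        emeasure N {d..<real (Suc k) * d} + emeasure N {real (Suc k) * d..<real (Suc (Suc k)) * d}"
      by (simp only:) (intro emeasure_subadditive; simp)
    also have "\<dots> \<le> ennreal (\<psi> (real k * d) - \<psi> 0) +
        ennreal (\<psi> (real (Suc k) * d) - \<psi> (real k * d))"
    proof (rule add_mono)
      show "emeasure N {d..<real (Suc k) * d} \<le> ennreal (\<psi> (real k * d) - \<psi> 0)"
        using Suc.IH Suc.prems(1) kd(1) by simp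
      have "emeasure N {real (Suc k) * d..<real (Suc (Suc k)) * d} \<le> h (real (Suc k) * d) * ennreal d"
        using piece[of "real (Suc k) * d" "real (Suc (Suc k)) * d"] Suc.prems(1)
        by (simp add: algebra_simps)
      also have "\<dots> \<le> ennreal (\<psi> (real (Suc k) * d) - \<psi> (real k * d))"
        using rate[of "real k * d" "real (Suc k) * d"] Suc.prems kd
        by (simp add: algebra_simps)
      finally show "emeasure N {real (Suc k) * d..<real (Suc (Suc k)) * d} \<le>
          ennreal (\<psi> (real (Suc k) * d) - \<psi> (real k * d))" .
    qed
    also have "\<dots> = ennreal (\<psi> (real (Suc k) * d) - \<psi> 0)"
      using mono_onD[OF mono, of 0 "real k * d"] mono_onD[OF mono, of "real k * d" "real (Suc k) * d"]
        kd Suc.prems \<open>0 < b\<close>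
      by (subst ennreal_plus[symmetric]) auto
    finally show ?case .
  qed
  define d where "d n = b / real (Suc n)" for n
  have d: "0 < d n" "real n * d n \<le> b" "real (Suc n) * d n = b" for n
    using \<open>0 < b\<close> by (auto simp: d_def field_simps)
  have "(\<Union>n. {d n..<b}) = {0<..<b}"
  proof (intro equalityI subsetI)
    fix s assume s: "s \<in> {0<..<b}"
    then obtain n where "inverse (real (Suc n)) < s / b"
      using reals_Archimedean[of "s / b"] \<open>0 < b\<close> by auto
    then have "d n \<le> s"
      using \<open>0 < b\<close> by (simp add: d_def field_simps)
    with s show "s \<in> (\<Union>n. {d n..<b})"
      by auto
  qed (use d(1) less_le_trans in auto)
  moreover have "incseq (\<lambda>n. {d n..<b})"
    using \<open>0 < b\<close> by (intro incseq_SucI) (auto simp: d_def field_simps)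
  ultimately have "emeasure N {0<..<b} = (SUP n. emeasure N {d n..<b})"
    by (subst SUP_emeasure_incseq) (auto simp: image_subset_iff)
  also have "\<dots> \<le> ennreal (\<psi> b - \<psi> 0)"
  proof (rule SUP_least)
    fix n
    have "emeasure N {d n..<b} \<le> ennreal (\<psi> (real n * d n) - \<psi> 0)"
      using cells[OF d(1) d(2), of n] by (simp only: d(3))
    also have "\<dots> \<le> ennreal (\<psi> b - \<psi> 0)"
      using mono_onD[OF mono, of "real n * d n" b] d(1)[of n] d(2)[of n] \<open>0 < b\<close>
      by (intro ennreal_leI) auto
    finally show "emeasure N {d n..<b} \<le> ennreal (\<psi> b - \<psi> 0)" .
  qed
  finally show ?thesis
    by (simp add: N_eq)
qed

text \<open>This lower bound reaches down to \<open>s = 0\<close>, as concavity and monotonicity on the closed end of the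
  interval require. The converse estimate that follows is restricted to \<open>s > 0\<close>, because a rate that
  blows up at \<open>0\<close> has no upper bound \<open>c\<close> there.\<close>
lemma set_integral_increment_ge:
  fixes H :: "real \<Rightarrow> real"
  assumes int: "set_integrable lborel {0<..<t} H" and s: "0 \<le> s" "s \<le> t"
    and nonneg: "\<And>u. 0 \<le> H u" and c: "\<And>u. s < u \<Longrightarrow> u < t \<Longrightarrow> c \<le> H u"
  shows "c * (t - s) \<le> (LINT u:{0<..<t}|lborel. H u) - (LINT u:{0<..<s}|lborel. H u)"
proof -
  have ints: "set_integrable lborel {0<..<s} H" "set_integrable lborel {s<..<t} (\<lambda>u. c)"
    using s by (auto intro: set_integrable_subset[OF int]) (simp add: set_integrable_def)
  have "(LINT u:{0<..<s}|lborel. H u) + (LINT u:{s<..<t}|lborel. c) =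
      (LINT u|lborel. indicator {0<..<s} u *\<^sub>R H u + indicator {s<..<t} u *\<^sub>R c)"
    using ints unfolding set_lebesgue_integral_def set_integrable_def
    by (rule Bochner_Integration.integral_add[symmetric])
  also have "\<dots> \<le> (LINT u:{0<..<t}|lborel. H u)"
    unfolding set_lebesgue_integral_def
    by (intro integral_mono Bochner_Integration.integrable_add
          ints[unfolded set_integrable_def] int[unfolded set_integrable_def])
       (use s nonneg c in \<open>auto simp: indicator_def\<close>)
  also have "(LINT u:{s<..<t}|lborel. c) = c * (t - s)"
    using s by (simp add: set_lebesgue_integral_def)
  finally show ?thesis by simp
qed

lemma set_integral_increment_le:
  fixes H :: "real \<Rightarrow> real"
  assumes int: "set_integrable lborel {0<..<t} H" and s: "0 < s" "s \<le> t"
    and c: "\<And>u. s \<le> u \<Longrightarrow> u < t \<Longrightarrow> H u \<le> c"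
  shows "(LINT u:{0<..<t}|lborel. H u) - (LINT u:{0<..<s}|lborel. H u) \<le> c * (t - s)"
proof -
  have ints: "set_integrable lborel {0<..<s} H" "set_integrable lborel {s..<t} (\<lambda>u. c)"
    using s by (auto intro: set_integrable_subset[OF int]) (simp add: set_integrable_def)
  have "(LINT u:{0<..<t}|lborel. H u) \<le>
      (LINT u|lborel. indicator {0<..<s} u *\<^sub>R H u + indicator {s..<t} u *\<^sub>R c)"
    unfolding set_lebesgue_integral_def
    by (intro integral_mono Bochner_Integration.integrable_add
          ints[unfolded set_integrable_def] int[unfolded set_integrable_def])
       (use s c in \<open>auto simp: indicator_def\<close>)
  also have "\<dots> = (LINT u:{0<..<s}|lborel. H u) + (LINT u:{s..<t}|lborel. c)"
    using ints unfolding set_lebesgue_integral_def set_integrable_def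
    by (rule Bochner_Integration.integral_add)
  also have "(LINT u:{s..<t}|lborel. c) = c * (t - s)"
    using s by (simp add: set_lebesgue_integral_def)
  finally show ?thesis by simp
qed


section \<open>The exact modulus at a point with the KL property\<close>

locale KL_point =
  fixes f :: "'a::euclidean_space \<Rightarrow> ereal" and xb :: 'a and U :: "'a set"
    and \<eta> :: ereal and \<phi> :: "real \<Rightarrow> real"
  assumes U_subset: "U \<subseteq> dom_subdiff f"
    and desingularizing: "concave_KL_wrt f xb U \<eta> \<phi>"
begin

abbreviation rate :: "real \<Rightarrow> ennreal" where
  "rate \<equiv> modulus_rate f xb U \<eta>"

abbreviation modulus :: "real \<Rightarrow> real" where
  "modulus \<equiv> exact_modulus f xb U \<eta>"

lemma level_bandE:
  assumes "x \<in> level_band f xb \<eta>"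
  obtains t where "f x - f xb = ereal t" "0 < t" "t \<in> ivl0 \<eta>"
  using assms by (cases "f x - f xb") (auto simp: level_band_def ivl0_def)

lemma antimono_rate: "antimono rate"
  unfolding modulus_rate_def
  by (intro antimonoI SUP_subset_mono) (auto intro: order_trans[OF ereal_less_eq(3)[THEN iffD2]])

lemma rate_ge:
  "x \<in> U \<Longrightarrow> x \<in> level_band f xb \<eta> \<Longrightarrow> f x - f xb = ereal t \<Longrightarrow>
    1 / dist_zero (limiting_subdiff f x) \<le> rate t"
  unfolding modulus_rate_def by (intro SUP_upper) auto

text \<open>This is where \<open>U\<close> has to lie in the domain of the subdifferential: an infinite distance has the
  reciprocal \<open>0\<close>, and such a point would contribute nothing to the rate. Finite distances make the
  rate positive on the reached part of the interval.\<close>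
lemma dist_zero_finite: "x \<in> U \<Longrightarrow> dist_zero (limiting_subdiff f x) < top"
  using U_subset by (auto simp: dom_subdiff_def dist_zero_def INF_less_iff)

lemma concave_KL_wrt_mono: "concave_KL_wrt f xb U \<eta> \<psi> \<Longrightarrow> mono_on (ivl0 \<eta>) \<psi>"
  by (auto simp: concave_KL_wrt_def Phi_class_def intro: strict_mono_on_imp_mono_on)

text \<open>Bounding the rate by slopes instead of left derivatives is what makes the estimate usable under
  the integral, because increments of \<open>\<psi>\<close> can be summed.\<close>
lemma rate_le_slope:
  assumes KL: "concave_KL_wrt f xb U \<eta> \<psi>" and s: "0 \<le> r" "r < s" "s \<in> ivl0 \<eta>"
  shows "rate s \<le> ennreal ((\<psi> s - \<psi> r) / (s - r))"
  unfolding modulus_rate_def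
proof (rule SUP_least)
  have conc: "concave_on (ivl0 \<eta>) \<psi>" and ineq: "KL_inequality f xb U \<eta> \<psi>"
    using KL by (auto simp: concave_KL_wrt_def)
  fix x assume "x \<in> {x \<in> U \<inter> level_band f xb \<eta>. ereal s \<le> f x - f xb}"
  then have x: "x \<in> U" "x \<in> level_band f xb \<eta>" "ereal s \<le> f x - f xb"
    by auto
  from x(2) obtain t where t: "f x - f xb = ereal t" "0 < t" "t \<in> ivl0 \<eta>"
    by (rule level_bandE)
  let ?d = "dist_zero (limiting_subdiff f x)"
  have one: "1 \<le> ?d * ennreal (left_deriv \<psi> t)"
    using bspec[OF ineq[unfolded KL_inequality_def], of x] x t(1) by (simp add: mult.commute)
  then have "?d \<noteq> 0"
    by auto
  then have "1 / ?d \<le> ennreal (left_deriv \<psi> t)"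
    using one by (intro divide_le_posI_ennreal) (auto simp: zero_less_iff_neq_zero)
  also have "left_deriv \<psi> t \<le> (\<psi> t - \<psi> r) / (t - r)"
    using s x(3) t by (intro left_deriv_le_slope[OF conc concave_KL_wrt_mono[OF KL]]) auto
  also have "\<dots> \<le> (\<psi> s - \<psi> r) / (s - r)"
    using concave_on_slope_le(1)[OF conc ivl0_downward[OF t(3) s(1)] t(3) s(2)] s x(3) t
    by (cases "s = t") auto
  finally show "1 / ?d \<le> ennreal ((\<psi> s - \<psi> r) / (s - r))"
    by (simp add: ennreal_leI)
qed

lemma rate_finite:
  assumes "s \<in> ivl0 \<eta>" "0 < s"
  shows "rate s < top"
  using rate_le_slope[OF desingularizing _ assms(2,1)] by (auto intro: le_less_trans)

text \<open>The special cases in the definition of the exact modulus agree with the integral: the rate vanishes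
  if no point is admissible, and the interval of integration is empty for \<open>t = 0\<close>.\<close>
lemma exact_modulus_eq_integral: "modulus t = (LINT s:{0<..<t}|lborel. enn2real (rate s))"
proof (cases "U \<inter> level_band f xb \<eta> = {}")
  case True
  then have "rate s = 0" for s
    by (auto simp: modulus_rate_def bot_ennreal)
  with True show ?thesis
    by (simp add: exact_modulus_def set_lebesgue_integral_def)
next
  case False
  then show ?thesis
    by (simp add: exact_modulus_def set_lebesgue_integral_def)
qed

lemma exact_modulus_0: "modulus 0 = 0"
  by (simp add: exact_modulus_def)

lemma borel_measurable_rate [measurable]: "rate \<in> borel_measurable borel"
  by (rule borel_measurable_antimono_ennreal[OF antimono_rate])

lemma nn_integral_rate_le:
  assumes KL: "concave_KL_wrt f xb U \<eta> \<psi>" and t: "t \<in> ivl0 \<eta>" "0 < t"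
  shows "(\<integral>\<^sup>+s\<in>{0<..<t}. rate s \<partial>lborel) \<le> ennreal (\<psi> t)"
proof -
  have "rate s * ennreal (s - r) \<le> ennreal (\<psi> s - \<psi> r)" if rs: "0 \<le> r" "r < s" "s \<le> t" for r s
  proof -
    have s: "s \<in> ivl0 \<eta>"
      using rs by (intro ivl0_downward[OF t(1)]) auto
    have "\<psi> r \<le> \<psi> s"
      using rs s by (intro mono_onD[OF concave_KL_wrt_mono[OF KL]] ivl0_downward[OF s]) auto
    have "rate s * ennreal (s - r) \<le> ennreal ((\<psi> s - \<psi> r) / (s - r)) * ennreal (s - r)"
      by (intro mult_right_mono rate_le_slope[OF KL rs(1,2) s]) simp
    also have "\<dots> = ennreal (\<psi> s - \<psi> r)"
      using rs \<open>\<psi> r \<le> \<psi> s\<close> by (simp flip: ennreal_mult)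
    finally show ?thesis .
  qed
  moreover have "mono_on {0..t} \<psi>"
    by (rule mono_on_subset[OF concave_KL_wrt_mono[OF KL]]) (auto intro: ivl0_downward[OF t(1)])
  ultimately have "(\<integral>\<^sup>+s\<in>{0<..<t}. rate s \<partial>lborel) \<le> ennreal (\<psi> t - \<psi> 0)"
    by (intro nn_integral_le_of_rate_bound[OF antimono_rate t(2)])
  then show ?thesis
    using KL by (simp add: concave_KL_wrt_def Phi_class_def)
qed

text \<open>Bridge between the rate in \<open>[0,\<infinity>]\<close>, for which the bounds are proved, and its real-valued
  version, in terms of which the exact modulus is defined.\<close>
lemma ennreal_enn2real_rate:
  assumes "t \<in> ivl0 \<eta>" "0 < s" "s \<le> t"
  shows "ennreal (enn2real (rate s)) = rate s"
  using rate_finite[OF ivl0_downward[OF assms(1)]] assms by simp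

lemma nn_integral_enn2real_rate:
  assumes t: "t \<in> ivl0 \<eta>"
  shows "(\<integral>\<^sup>+s. ennreal (indicator {0<..<t} s *\<^sub>R enn2real (rate s)) \<partial>lborel) =
    (\<integral>\<^sup>+s\<in>{0<..<t}. rate s \<partial>lborel)"
  by (intro nn_integral_cong) (auto simp: indicator_def ennreal_enn2real_rate[OF t])

lemma set_integrable_rate:
  assumes t: "t \<in> ivl0 \<eta>"
  shows "set_integrable lborel {0<..<t} (\<lambda>s. enn2real (rate s))"
proof (cases "0 < t")
  case True
  show ?thesis
    unfolding set_integrable_def
  proof (rule integrableI_nonneg)
    show "(\<integral>\<^sup>+s. ennreal (indicator {0<..<t} s *\<^sub>R enn2real (rate s)) \<partial>lborel) < \<infinity>"
      unfolding nn_integral_enn2real_rate[OF t]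
      using nn_integral_rate_le[OF desingularizing t True] by (auto intro: le_less_trans)
  qed auto
next
  case False
  then show ?thesis
    by (simp add: set_integrable_def)
qed

lemma exact_modulus_le:
  assumes KL: "concave_KL_wrt f xb U \<eta> \<psi>" and t: "t \<in> ivl0 \<eta>"
  shows "modulus t \<le> \<psi> t"
proof (cases "0 < t")
  case True
  have "modulus t = enn2real (\<integral>\<^sup>+s\<in>{0<..<t}. rate s \<partial>lborel)"
    unfolding exact_modulus_eq_integral set_lebesgue_integral_def nn_integral_enn2real_rate[OF t, symmetric]
    by (intro integral_eq_nn_integral) auto
  also have "\<dots> \<le> enn2real (ennreal (\<psi> t))"
    by (intro enn2real_mono nn_integral_rate_le[OF KL t True]) simp
  finally show ?thesis
    using KL t by (simp add: concave_KL_wrt_def Phi_class_def)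
next
  case False
  then have "t = 0"
    using t by (simp add: ivl0_def)
  then show ?thesis
    using KL by (simp add: exact_modulus_0 concave_KL_wrt_def Phi_class_def)
qed

lemma enn2real_rate_antimono:
  assumes "t \<in> ivl0 \<eta>" "0 < s" "s \<le> t"
  shows "enn2real (rate t) \<le> enn2real (rate s)"
  using assms by (intro enn2real_mono antimonoD[OF antimono_rate] rate_finite ivl0_downward[OF assms(1)]) auto

lemma exact_modulus_increment_ge:
  assumes "t \<in> ivl0 \<eta>" "0 \<le> s" "s \<le> t"
  shows "enn2real (rate t) * (t - s) \<le> modulus t - modulus s"
  unfolding exact_modulus_eq_integral using assms
  by (intro set_integral_increment_ge set_integrable_rate enn2real_rate_antimono) auto

lemma exact_modulus_increment_le:
  assumes "t \<in> ivl0 \<eta>" "0 < s" "s \<le> t"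
  shows "modulus t - modulus s \<le> enn2real (rate s) * (t - s)"
  unfolding exact_modulus_eq_integral using assms
  by (intro set_integral_increment_le set_integrable_rate enn2real_rate_antimono)
     (auto intro: ivl0_downward)

lemma exact_modulus_mono: "mono_on (ivl0 \<eta>) modulus"
proof (rule mono_onI)
  fix s t assume st: "s \<in> ivl0 \<eta>" "t \<in> ivl0 \<eta>" "s \<le> t"
  then have "0 \<le> enn2real (rate t) * (t - s)"
    by simp
  also have "\<dots> \<le> modulus t - modulus s"
    using st by (intro exact_modulus_increment_ge) (auto simp: ivl0_def)
  finally show "modulus s \<le> modulus t"
    by simp
qed

lemma exact_modulus_nonneg: "t \<in> ivl0 \<eta> \<Longrightarrow> 0 \<le> modulus t"
  using mono_onD[OF exact_modulus_mono, of 0 t] ivl0_downward[of t \<eta> 0]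
  by (simp add: exact_modulus_0 ivl0_def)

text \<open>At an intermediate point \<open>z\<close> the slope on the left is at least \<open>h z\<close> and the slope on the right
  at most \<open>h z\<close>.\<close>
lemma exact_modulus_concave: "concave_on (ivl0 \<eta>) modulus"
proof (rule concave_on_linorderI[OF _ convex_ivl0])
  fix u x y :: real
  assume u: "0 < u" "u < 1" and x: "x \<in> ivl0 \<eta>" and y: "y \<in> ivl0 \<eta>" and "x < y"
  define z where "z = (1 - u) *\<^sub>R x + u *\<^sub>R y"
  have zx: "z - x = u * (y - x)" and yz: "y - z = (1 - u) * (y - x)"
    by (auto simp: z_def algebra_simps)
  have "0 < z - x" "0 < y - z"
    unfolding zx yz using u \<open>x < y\<close> by auto
  moreover have "0 \<le> x"
    using x by (simp add: ivl0_def)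
  ultimately have z: "x < z" "z < y" "0 < z" "0 \<le> x" "z \<in> ivl0 \<eta>"
    using ivl0_downward[OF y, of z] by auto
  let ?H = "enn2real (rate z)"
  have "u * (modulus y - modulus z) \<le> u * (?H * (y - z))"
    using u z y by (intro mult_left_mono exact_modulus_increment_le) auto
  also have "\<dots> = (1 - u) * (?H * (z - x))"
    by (simp add: zx yz)
  also have "\<dots> \<le> (1 - u) * (modulus z - modulus x)"
    using u z by (intro mult_left_mono exact_modulus_increment_ge) auto
  finally show "(1 - u) * modulus x + u * modulus y \<le> modulus ((1 - u) *\<^sub>R x + u *\<^sub>R y)"
    unfolding z_def[symmetric] by (simp add: algebra_simps)
qed

lemma exact_modulus_continuous: "continuous (at_right 0) modulus"
proof -
  have \<phi>: "continuous (at_right 0) \<phi>" "\<phi> 0 = 0" and "0 < \<eta>"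
    using desingularizing by (auto simp: concave_KL_wrt_def Phi_class_def)
  have "\<exists>b>0. b \<in> ivl0 \<eta>"
    using ereal_dense2[OF \<open>0 < \<eta>\<close>] by (auto simp: ivl0_def intro: less_imp_le)
  then obtain b where b: "0 < b" "b \<in> ivl0 \<eta>"
    by blast
  have bounds: "0 \<le> modulus t \<and> modulus t \<le> \<phi> t" if "t \<in> {0<..<b}" for t
    using exact_modulus_nonneg exact_modulus_le[OF desingularizing] ivl0_downward[OF b(2), of t] that
    by auto
  have "(modulus \<longlongrightarrow> 0) (at_right 0)"
  proof (rule tendsto_sandwich[OF _ _ tendsto_const])
    show "(\<phi> \<longlongrightarrow> 0) (at_right 0)"
      using \<phi> by (simp add: continuous_within)
  qed (use bounds b(1) in \<open>auto intro!: eventually_at_rightI[of 0 b]\<close>)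
  then show ?thesis
    by (simp add: continuous_within exact_modulus_0)
qed

text \<open>A converse of \<open>rate_le_slope\<close>, stated for an arbitrary \<open>\<psi>\<close> because it is needed both for the
  exact modulus and for its strictly increasing perturbations. A distance \<open>0\<close> cannot occur, since it would
  make the rate infinite.\<close>
lemma KL_inequality_of_increments:
  assumes conc: "concave_on (ivl0 \<eta>) \<psi>" and mono: "mono_on (ivl0 \<eta>) \<psi>"
    and incr: "\<And>s t. t \<in> ivl0 \<eta> \<Longrightarrow> 0 \<le> s \<Longrightarrow> s < t \<Longrightarrow> enn2real (rate t) * (t - s) \<le> \<psi> t - \<psi> s"
  shows "KL_inequality f xb U \<eta> \<psi>"
  unfolding KL_inequality_def
proof
  fix x assume "x \<in> U \<inter> level_band f xb \<eta>"
  then have x: "x \<in> U" "x \<in> level_band f xb \<eta>"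
    by auto
  from x(2) obtain t where t: "f x - f xb = ereal t" "0 < t" "t \<in> ivl0 \<eta>"
    by (rule level_bandE)
  let ?d = "dist_zero (limiting_subdiff f x)"
  note d = rate_ge[OF x t(1)]
  have "?d \<noteq> 0"
    using d rate_finite[OF t(3,2)] by auto
  then have "1 = 1 / ?d * ?d"
    using dist_zero_finite[OF x(1)] by (simp add: ennreal_divide_times)
  also have "\<dots> \<le> ennreal (enn2real (rate t)) * ?d"
    using d ennreal_enn2real_rate[OF t(3,2)] by (intro mult_right_mono) auto
  also have "\<dots> \<le> ennreal (left_deriv \<psi> t) * ?d"
    using t incr by (intro mult_right_mono ennreal_leI left_deriv_ge[OF conc mono]) auto
  finally show "1 \<le> ennreal (left_deriv \<psi> (real_of_ereal (f x - f xb))) * ?d"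
    by (simp add: t(1))
qed

lemma rate_pos:
  assumes "t \<in> reached_ivl f xb U \<eta>" "0 < t"
  shows "0 < enn2real (rate t)"
proof -
  obtain x where x: "x \<in> U" "x \<in> level_band f xb \<eta>" "ereal t \<le> f x - f xb"
    and t: "t \<in> ivl0 \<eta>"
    using assms by (auto simp: reached_ivl_def)
  have "0 < 1 / dist_zero (limiting_subdiff f x)"
    using dist_zero_finite[OF x(1)] by (simp add: ennreal_zero_less_divide)
  also have "\<dots> \<le> rate t"
    unfolding modulus_rate_def using x by (intro SUP_upper) auto
  finally show ?thesis
    using rate_finite[OF t assms(2)] by (simp add: enn2real_positive_iff)
qed

lemma exact_modulus_strict_mono: "strict_mono_on (reached_ivl f xb U \<eta>) modulus"
proof (rule strict_mono_onI)
  fix s t assume st: "s \<in> reached_ivl f xb U \<eta>" "t \<in> reached_ivl f xb U \<eta>" "s < t"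
  then have "0 \<le> s" "t \<in> ivl0 \<eta>"
    by (auto simp: reached_ivl_def ivl0_def)
  have "0 < enn2real (rate t) * (t - s)"
    using rate_pos[OF st(2)] st(3) \<open>0 \<le> s\<close> by simp
  also have "\<dots> \<le> modulus t - modulus s"
    using \<open>0 \<le> s\<close> \<open>t \<in> ivl0 \<eta>\<close> st(3) by (intro exact_modulus_increment_ge) auto
  finally show "modulus s < modulus t"
    by simp
qed

lemma exact_modulus_KL_reached: "concave_KL_wrt_reached f xb U \<eta> modulus"
proof -
  have "KL_inequality f xb U \<eta> modulus"
    by (intro KL_inequality_of_increments exact_modulus_concave exact_modulus_mono
        exact_modulus_increment_ge) auto
  then show ?thesis
    using desingularizing exact_modulus_continuous exact_modulus_mono exact_modulus_strict_mono
      exact_modulus_concave exact_modulus_nonneg exact_modulus_0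
    by (auto simp: concave_KL_wrt_reached_def concave_KL_wrt_def)
qed

text \<open>The exact modulus need not be strictly increasing beyond the reached values, so it may fail to be
  a member of the family over which the infimum is taken. A small linear term repairs this.\<close>
lemma perturbed_exact_modulus_KL:
  assumes "0 < \<epsilon>"
  shows "concave_KL_wrt f xb U \<eta> (\<lambda>t. modulus t + \<epsilon> * t)"
proof -
  have incr: "enn2real (rate t) * (t - s) + \<epsilon> * (t - s) \<le> modulus t + \<epsilon> * t - (modulus s + \<epsilon> * s)"
    if "t \<in> ivl0 \<eta>" "0 \<le> s" "s \<le> t" for s t
    using exact_modulus_increment_ge[OF that] by (simp add: algebra_simps)
  have smono: "strict_mono_on (ivl0 \<eta>) (\<lambda>t. modulus t + \<epsilon> * t)"
    using mono_onD[OF exact_modulus_mono] assms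
    by (intro strict_mono_onI add_le_less_mono) (auto simp: less_imp_le)
  have "concave_on (ivl0 \<eta>) (\<lambda>t. \<epsilon> * t)"
    unfolding concave_on_iff using convex_ivl0 by (auto simp: algebra_simps)
  then have conc: "concave_on (ivl0 \<eta>) (\<lambda>t. modulus t + \<epsilon> * t)"
    by (intro concave_on_add exact_modulus_concave)
  have "KL_inequality f xb U \<eta> (\<lambda>t. modulus t + \<epsilon> * t)"
  proof (rule KL_inequality_of_increments[OF conc strict_mono_on_imp_mono_on[OF smono]])
    fix s t assume st: "t \<in> ivl0 \<eta>" "0 \<le> s" "s < t"
    have "0 \<le> \<epsilon> * (t - s)"
      using assms st by simp
    with incr[of t s] st
    show "enn2real (rate t) * (t - s) \<le> modulus t + \<epsilon> * t - (modulus s + \<epsilon> * s)"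
      by linarith
  qed
  moreover have "0 \<le> modulus t + \<epsilon> * t" if "t \<in> ivl0 \<eta>" for t
    using exact_modulus_nonneg[OF that] that assms by (simp add: ivl0_def)
  ultimately show ?thesis
    using desingularizing smono conc exact_modulus_continuous
    by (auto simp: concave_KL_wrt_def Phi_class_def exact_modulus_0 intro!: continuous_intros)
qed

lemma exact_modulus_eq_INF:
  assumes t: "t \<in> ivl0 \<eta>"
  shows "modulus t = (INF \<psi> \<in> {\<psi>. concave_KL_wrt f xb U \<eta> \<psi>}. \<psi> t)"
proof (rule cInf_eq_non_empty[symmetric])
  show "(\<lambda>\<psi>. \<psi> t) ` {\<psi>. concave_KL_wrt f xb U \<eta> \<psi>} \<noteq> {}"
    using desingularizing by auto
next
  fix y assume "y \<in> (\<lambda>\<psi>. \<psi> t) ` {\<psi>. concave_KL_wrt f xb U \<eta> \<psi>}"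
  then show "modulus t \<le> y"
    using exact_modulus_le t by auto
next
  fix y assume y: "\<And>z. z \<in> (\<lambda>\<psi>. \<psi> t) ` {\<psi>. concave_KL_wrt f xb U \<eta> \<psi>} \<Longrightarrow> y \<le> z"
  have le: "y \<le> modulus t + \<epsilon> * t" if "0 < \<epsilon>" for \<epsilon>
    using y perturbed_exact_modulus_KL[OF that] by auto
  have "((\<lambda>\<epsilon>. modulus t + \<epsilon> * t) \<longlongrightarrow> modulus t + 0 * t) (at_right 0)"
    by (intro tendsto_intros)
  then have "y \<le> modulus t + 0 * t"
    by (rule tendsto_lowerbound) (use le in \<open>auto intro!: eventually_at_rightI[of 0 1]\<close>)
  then show "y \<le> modulus t"
    by simp
qed

end

theorem proposition3p9:
  fixes f :: "real ^ 'n \<Rightarrow> ereal" and xb :: "real ^ 'n" and U :: "(real ^ 'n) set"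
    and \<eta> :: ereal and \<phi> :: "real \<Rightarrow> real"
  assumes "proper_fun f" and "lsc_fun f"
    and "xb \<in> dom_subdiff f"
    and "U \<noteq> {}" and "xb \<in> interior U" and "U \<subseteq> dom_subdiff f"
    and "0 < \<eta>"
    and "\<phi> \<in> Phi_class \<eta>" and "concave_on (ivl0 \<eta>) \<phi>"
    and "concave_KL_wrt f xb U \<eta> \<phi>"
  shows "exact_modulus_well_defined f xb U \<eta> \<and>
    concave_on (ivl0 \<eta>) (exact_modulus f xb U \<eta>) \<and>
    (\<forall>t\<in>ivl0 \<eta>. exact_modulus f xb U \<eta> t \<le> \<phi> t) \<and>
    concave_KL_wrt_reached f xb U \<eta> (exact_modulus f xb U \<eta>) \<and>
    (reached_ivl f xb U \<eta> = ivl0 \<eta> \<longrightarrow> concave_KL_wrt f xb U \<eta> (exact_modulus f xb U \<eta>)) \<and>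
    (\<forall>t\<in>ivl0 \<eta>. exact_modulus f xb U \<eta> t = (INF \<psi> \<in> {\<psi>. concave_KL_wrt f xb U \<eta> \<psi>}. \<psi> t))"
proof -
  interpret KL_point f xb U \<eta> \<phi>
    using assms(6,10) by unfold_locales
  have "exact_modulus_well_defined f xb U \<eta>"
    using rate_finite set_integrable_rate exact_modulus_nonneg
    by (auto simp: exact_modulus_well_defined_def ivl0_def)
  moreover have "reached_ivl f xb U \<eta> = ivl0 \<eta> \<longrightarrow> concave_KL_wrt f xb U \<eta> modulus"
    using exact_modulus_KL_reached
    by (auto simp: concave_KL_wrt_reached_def concave_KL_wrt_def Phi_class_def)
  ultimately show ?thesis
    using exact_modulus_concave exact_modulus_le[OF desingularizing] exact_modulus_KL_reached
      exact_modulus_eq_INF by blast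
qed

end
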